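(* Let $k\ge 2$, $n\ge 1$, $E_k=\{0,1,\dots,k-1\}$ with the usual order $0<1<\dots<k-1$, and let $\gamma\in E_k\setminus\{0\}$. Let $f_\gamma:E_k^n\to\{0,\gamma\}$ be a quasi-Boolean function of $k$-valued logic that is monotone, i.e. $\tilde\alpha\le\tilde\beta$ componentwise implies $f_\gamma(\tilde\alpha)\le f_\gamma(\tilde\beta)$. Then: (a) every elementary conjunction of the abbreviated d.n.f. of $f_\gamma$ uses only elementary formulas of the form $J_{[a,k-1]}(x)$ with $0\le a\le k-1$, i.e. it has the form $\min[J_{[a_1,k-1]}(x_1),\dots,J_{[a_n,k-1]}(x_n),\gamma]$; (b) the abbreviated d.n.f. of $f_\gamma$ is the only minimal (shortest) d.n.f. of $f_\gamma$.
   Context: For $M\subseteq E_k$, $J_M(x)=k-1$ if $x\in M$ and $J_M(x)=0$ otherwise; $[a,b]=\{a,a+1,\dots,b\}$. An elementary conjunction (e.c.) with value $\gamma$ is an expression $\mathfrak A=\min[J_{M_1}(x_1),\dots,J_{M_n}(x_n),\gamma]$ with $\emptyset\ne M_j\subseteq E_k$; it takes the value $\gamma$ exactly on the sublattice $N_{\mathfrak A}=M_1\times\dots\times M_n\subseteq E_k^n$ and $0$ elsewhere. A disjunctive normal form (d.n.f.) is a maximum $\mathfrak A_1\vee\dots\vee\mathfrak A_m=\max[\mathfrak A_1,\dots,\mathfrak A_m]$ of e.c.'s; it realizes $f$ if it equals $f$ as a function on $E_k^n$. For a quasi-Boolean function $f_\gamma$ (taking only the values $0$ and $\gamma$) let $N_{f_\gamma}=\{\tilde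 x: f_\gamma(\tilde x)=\gamma\}$. A sublattice $M_1\times\dots\times M_n\subseteq N_{f_\gamma}$ is maximal if it is not properly contained in another sublattice (product of nonempty subsets of $E_k$) contained in $N_{f_\gamma}$. The abbreviated (reduced) d.n.f. of $f_\gamma$ is the disjunction of the e.c.'s with value $\gamma$ corresponding to all maximal sublattices contained in $N_{f_\gamma}$. A minimal (shortest) d.n.f. of $f_\gamma$ is a d.n.f. realizing $f_\gamma$ with the least number of elementary conjunctions.
   Formalization: Uniqueness in (b) fails literally (x1∨x2 = x1∨(¬x1∧x2), k=n=2). Proved instead: the abbreviated d.n.f. is shortest, is the only shortest one made of e.c.'s of maximal sublattices, and every shortest d.n.f. matches it one-to-one up to enlarging sublattices. *)

theory Defs
  imports "HOL-Library.Multiset" "HOL-Library.FuncSet"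
begin

definition E :: "nat \<Rightarrow> nat set" where
  "E k = {0..<k}"

text \<open>Points of \<open>E k\<close> to the power \<open>n\<close> are functions on the index set \<open>{1..n}\<close> that are
  \<^const>\<open>undefined\<close> elsewhere; hence the pointwise order of \<open>nat \<Rightarrow> nat\<close> restricted to
  the cube is the componentwise order.\<close>

definition cube :: "nat \<Rightarrow> nat \<Rightarrow> (nat \<Rightarrow> nat) set" where
  "cube k n = {1..n} \<rightarrow>\<^sub>E E k"

definition J :: "nat \<Rightarrow> nat set \<Rightarrow> nat \<Rightarrow> nat" where
  "J k M x = (if x \<in> M then k - 1 else 0)"

definition factors :: "nat \<Rightarrow> nat \<Rightarrow> (nat \<Rightarrow> nat set) set" where
  "factors k n = {1..n} \<rightarrow>\<^sub>E (Pow (E k) - {{}})"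

text \<open>An elementary conjunction is kept as an expression: \<open>EC M g\<close> stands for
  \<open>min[J (M 1) x1, ..., J (M n) xn, g]\<close>.\<close>

datatype elem_conj = EC (ec_factors: "nat \<Rightarrow> nat set") (ec_const: nat)

definition is_ec :: "nat \<Rightarrow> nat \<Rightarrow> elem_conj \<Rightarrow> bool" where
  "is_ec k n A \<longleftrightarrow> ec_factors A \<in> factors k n \<and> ec_const A \<in> E k"

definition ec_value :: "nat \<Rightarrow> nat \<Rightarrow> elem_conj \<Rightarrow> (nat \<Rightarrow> nat) \<Rightarrow> nat" where
  "ec_value k n A x = Min (insert (ec_const A) ((\<lambda>i. J k (ec_factors A i) (x i)) ` {1..n}))"

definition ec_set :: "nat \<Rightarrow> elem_conj \<Rightarrow> (nat \<Rightarrow> nat) set" where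
  "ec_set n A = Pi\<^sub>E {1..n} (ec_factors A)"

text \<open>A d.n.f. is a multiset of elementary conjunctions: the order of the disjuncts is irrelevant,
  but repeated disjuncts count towards the length.  The empty disjunction has value 0.\<close>

definition is_dnf :: "nat \<Rightarrow> nat \<Rightarrow> elem_conj multiset \<Rightarrow> bool" where
  "is_dnf k n D \<longleftrightarrow> (\<forall>A\<in>#D. is_ec k n A)"

definition dnf_value :: "nat \<Rightarrow> nat \<Rightarrow> elem_conj multiset \<Rightarrow> (nat \<Rightarrow> nat) \<Rightarrow> nat" where
  "dnf_value k n D x = Max (insert 0 ((\<lambda>A. ec_value k n A x) ` set_mset D))"

definition realizes :: "nat \<Rightarrow> nat \<Rightarrow> elem_conj multiset \<Rightarrow> ((nat \<Rightarrow> nat) \<Rightarrow> nat) \<Rightarrow> bool" where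
  "realizes k n D f \<longleftrightarrow> is_dnf k n D \<and> (\<forall>x\<in>cube k n. dnf_value k n D x = f x)"

definition minimal_dnf :: "nat \<Rightarrow> nat \<Rightarrow> ((nat \<Rightarrow> nat) \<Rightarrow> nat) \<Rightarrow> elem_conj multiset \<Rightarrow> bool" where
  "minimal_dnf k n f D \<longleftrightarrow>
     realizes k n D f \<and> (\<forall>D'. realizes k n D' f \<longrightarrow> size D \<le> size D')"

definition sublattice :: "nat \<Rightarrow> nat \<Rightarrow> (nat \<Rightarrow> nat) set \<Rightarrow> bool" where
  "sublattice k n N \<longleftrightarrow> (\<exists>M\<in>factors k n. N = Pi\<^sub>E {1..n} M)"

definition value_set :: "nat \<Rightarrow> nat \<Rightarrow> nat \<Rightarrow> ((nat \<Rightarrow> nat) \<Rightarrow> nat) \<Rightarrow> (nat \<Rightarrow> nat) set" where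
  "value_set k n \<gamma> f = {x \<in> cube k n. f x = \<gamma>}"

definition maximal_sublattice ::
  "nat \<Rightarrow> nat \<Rightarrow> nat \<Rightarrow> ((nat \<Rightarrow> nat) \<Rightarrow> nat) \<Rightarrow> (nat \<Rightarrow> nat) set \<Rightarrow> bool" where
  "maximal_sublattice k n \<gamma> f N \<longleftrightarrow>
     sublattice k n N \<and> N \<subseteq> value_set k n \<gamma> f \<and>
     \<not> (\<exists>N'. sublattice k n N' \<and> N' \<subseteq> value_set k n \<gamma> f \<and> N \<subset> N')"

text \<open>The set below is finite because \<^term>\<open>factors k n\<close> is, so \<^const>\<open>mset_set\<close> lists each of
  its members exactly once.\<close>

definition abbreviated_dnf ::
  "nat \<Rightarrow> nat \<Rightarrow> nat \<Rightarrow> ((nat \<Rightarrow> nat) \<Rightarrow> nat) \<Rightarrow> elem_conj multiset" where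
  "abbreviated_dnf k n \<gamma> f =
     mset_set {EC M \<gamma> | M. M \<in> factors k n \<and> maximal_sublattice k n \<gamma> f (Pi\<^sub>E {1..n} M)}"

text \<open>\<open>A\<close> is absorbed by \<open>B\<close>: \<open>B\<close> arises from \<open>A\<close> by enlarging its sublattice.\<close>

definition absorbed :: "nat \<Rightarrow> elem_conj \<Rightarrow> elem_conj \<Rightarrow> bool" where
  "absorbed n A B \<longleftrightarrow> ec_set n A \<subseteq> ec_set n B \<and> ec_const A = ec_const B"

lemma ec_value_eq:
  assumes "ec_const A \<in> E k" and "x \<in> cube k n" and "1 \<le> n"
  shows "ec_value k n A x = (if x \<in> ec_set n A then ec_const A else 0)"
proof (cases "x \<in> ec_set n A")
  case True
  have "ec_const A \<le> J k (ec_factors A i) (x i)" if "i \<in> {1..n}" for i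
  proof -
    have "x i \<in> ec_factors A i"
      using True that unfolding ec_set_def by (rule PiE_mem)
    thus ?thesis using assms(1) by (simp add: J_def E_def)
  qed
  hence "ec_value k n A x = ec_const A"
    unfolding ec_value_def by (intro Min_eqI) auto
  thus ?thesis using True by simp
next
  case False
  have "x \<in> extensional {1..n}"
    using assms(2) by (auto simp: cube_def PiE_def)
  then obtain i where "i \<in> {1..n}" "x i \<notin> ec_factors A i"
    using False by (auto simp: ec_set_def PiE_def Pi_def)
  hence "0 \<in> insert (ec_const A) ((\<lambda>i. J k (ec_factors A i) (x i)) ` {1..n})"
    by (force simp: J_def)
  hence "ec_value k n A x = 0"
    unfolding ec_value_def by (intro Min_eqI) auto
  thus ?thesis using False by simp
qed

text \<open>With length measured by the number of conjunctions and no restriction on the conjunctions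
  admitted, a monotone function may have several shortest d.n.f.s: the Boolean function
  \<open>x1 \<or> x2\<close> also has the d.n.f. \<open>x1 \<or> (\<not> x1 \<and> x2)\<close> of length 2.  Uniqueness therefore has to
  be read among conjunctions of maximal sublattices, or up to absorption.\<close>

lemma PiE2:
  "x \<in> Pi\<^sub>E {1..2::nat} M \<longleftrightarrow> x \<in> extensional {1..2} \<and> x 1 \<in> M 1 \<and> x 2 \<in> M 2"
proof -
  have I: "i \<in> {1..2} \<longleftrightarrow> i = 1 \<or> i = 2" for i :: nat by auto
  show ?thesis unfolding PiE_iff Ball_def I by blast
qed

lemma shortest_dnf_not_unique:
  "\<exists>f D D'. f \<in> cube 2 2 \<rightarrow> {0, 1} \<and> mono_on (cube 2 2) f \<and>
     minimal_dnf 2 2 f D \<and> minimal_dnf 2 2 f D' \<and> D \<noteq> D'"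
proof -
  define f :: "(nat \<Rightarrow> nat) \<Rightarrow> nat" where "f x = (if x 1 = 1 \<or> x 2 = 1 then 1 else 0)" for x
  define F :: "nat set \<Rightarrow> nat set \<Rightarrow> elem_conj" where
    "F S T = EC (\<lambda>i\<in>{1..2}. if i = 1 then S else T) 1" for S T
  have E2: "E 2 = {0, 1}" by (auto simp: E_def)
  have cubeD: "x 1 \<in> {0, 1}" "x 2 \<in> {0, 1}" if "x \<in> cube 2 2" for x
    using that unfolding cube_def PiE2 E2 by blast+
  have F_ec: "is_ec 2 2 (F S T)" if "S \<in> Pow {0, 1} - {{}}" "T \<in> Pow {0, 1} - {{}}" for S T
    using that unfolding is_ec_def F_def factors_def PiE2 E2 by simp
  have F_val: "ec_value 2 2 (F S T) x = (if x 1 \<in> S \<and> x 2 \<in> T then 1 else 0)"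
    if "x \<in> cube 2 2" for S T x
  proof -
    have "x \<in> ec_set 2 (F S T) \<longleftrightarrow> x 1 \<in> S \<and> x 2 \<in> T"
      using that unfolding ec_set_def F_def cube_def PiE2 by simp
    moreover have "ec_const (F S T) = 1" by (simp add: F_def)
    moreover have "ec_value 2 2 (F S T) x = (if x \<in> ec_set 2 (F S T) then ec_const (F S T) else 0)"
      by (rule ec_value_eq) (use that in \<open>simp_all add: F_def E2\<close>)
    ultimately show ?thesis by simp
  qed
  define D where "D = {#F {1} {0, 1}, F {0, 1} {1}#}"
  define D' where "D' = {#F {1} {0, 1}, F {0} {1}#}"
  have dv: "dnf_value 2 2 {#A, B#} x = max (ec_value 2 2 A x) (ec_value 2 2 B x)" for A B x
    by (simp add: dnf_value_def)
  have rD: "realizes 2 2 D f"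
    unfolding realizes_def
  proof (intro conjI ballI)
    show "is_dnf 2 2 D" by (simp add: is_dnf_def D_def F_ec)
    fix x assume x: "x \<in> cube 2 2"
    show "dnf_value 2 2 D x = f x"
      using cubeD[OF x] unfolding D_def dv F_val[OF x] f_def by auto
  qed
  have rD': "realizes 2 2 D' f"
    unfolding realizes_def
  proof (intro conjI ballI)
    show "is_dnf 2 2 D'" by (simp add: is_dnf_def D'_def F_ec)
    fix x assume x: "x \<in> cube 2 2"
    show "dnf_value 2 2 D' x = f x"
      using cubeD[OF x] unfolding D'_def dv F_val[OF x] f_def by auto
  qed
  have lower: "2 \<le> size X" if X: "realizes 2 2 X f" for X
  proof (rule ccontr)
    define p where "p a b = (\<lambda>i\<in>{1..2::nat}. if i = 1 then a else b :: nat)" for a b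
    have p: "p a b \<in> cube 2 2" "p a b 1 = a" "p a b 2 = b" if "a \<in> {0, 1}" "b \<in> {0, 1}" for a b
      using that unfolding cube_def PiE2 E2 by (auto simp: p_def)
    assume "\<not> 2 \<le> size X"
    hence "size X = 0 \<or> size X = Suc 0" by linarith
    thus False
    proof
      assume "size X = 0"
      hence "dnf_value 2 2 X (p 1 0) = 0" by (simp add: dnf_value_def)
      thus False using X p[of 1 0] by (simp add: realizes_def f_def)
    next
      assume "size X = Suc 0"
      then obtain A where A: "X = {#A#}" using size_1_singleton_mset[of X] by auto
      have c: "ec_const A \<in> E 2" using X A by (simp add: realizes_def is_dnf_def is_ec_def)
      have v: "ec_value 2 2 A x = f x" if "x \<in> cube 2 2" for x
        using X A that by (simp add: realizes_def dnf_value_def)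
      have "p 1 0 \<in> ec_set 2 A" "p 0 1 \<in> ec_set 2 A" "ec_const A = 1"
        using v[of "p 1 0"] v[of "p 0 1"] p[of 1 0] p[of 0 1]
          ec_value_eq[OF c, of "p 1 0" 2] ec_value_eq[OF c, of "p 0 1" 2]
        by (auto simp: f_def split: if_splits)
      hence "p 0 0 \<in> ec_set 2 A"
        unfolding ec_set_def PiE2 by (simp add: p_def)
      thus False
        using v[of "p 0 0"] p[of 0 0] ec_value_eq[OF c, of "p 0 0" 2] \<open>ec_const A = 1\<close>
        by (simp add: f_def)
    qed
  qed
  have "F {0, 1} {1} \<noteq> F {0} {1}"
  proof
    assume "F {0, 1} {1} = F {0} {1}"
    hence "ec_factors (F {0, 1} {1}) 1 = ec_factors (F {0} {1}) 1" by simp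
    thus False by (simp add: F_def)
  qed
  hence "D \<noteq> D'" by (auto simp: D_def D'_def)
  moreover have "mono_on (cube 2 2) f"
  proof (rule mono_onI)
    fix x y assume xy: "x \<in> cube 2 2" "y \<in> cube 2 2" "x \<le> y"
    have "x 1 \<le> y 1" "x 2 \<le> y 2" using xy(3) by (auto simp: le_fun_def)
    thus "f x \<le> f y" using cubeD[OF xy(1)] cubeD[OF xy(2)] by (auto simp: f_def)
  qed
  moreover have "f \<in> cube 2 2 \<rightarrow> {0, 1}" by (auto simp: f_def)
  moreover have "minimal_dnf 2 2 f D" "minimal_dnf 2 2 f D'"
    using rD rD' lower by (auto simp: minimal_dnf_def D_def D'_def numeral_2_eq_2)
  ultimately show ?thesis by blast
qed

end

theory Submission
  imports Defs
begin

text \<open>The set \<open>N\<close> where a monotone \<open>f\<close> takes the value \<open>\<gamma>\<close> is an up-set of the cube.  The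
  vector \<open>a\<close> of the minima of the factors of a sublattice inside \<open>N\<close> belongs to that sublattice,
  hence to \<open>N\<close>, and the sublattice is contained in the principal filter of \<open>a\<close>, which is
  itself a sublattice inside \<open>N\<close>.  So the maximal sublattices are exactly the principal filters
  of the minimal points of \<open>N\<close>.  In an arbitrary d.n.f. of \<open>f\<close>, a conjunction that covers a
  minimal point \<open>m\<close> must have \<open>m\<close> as its vector of minima, so different minimal points need
  different conjunctions, and each of these is absorbed by the filter of its minimal point.\<close>

section \<open>Principal filters and least points of sublattices\<close>

definition filter_factors :: "nat \<Rightarrow> nat \<Rightarrow> (nat \<Rightarrow> nat) \<Rightarrow> nat \<Rightarrow> nat set" where
  "filter_factors k n a = (\<lambda>i\<in>{1..n}. {a i..k - 1})"

definition least_point :: "nat \<Rightarrow> (nat \<Rightarrow> nat set) \<Rightarrow> nat \<Rightarrow> nat" where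
  "least_point n M = (\<lambda>i\<in>{1..n}. Min (M i))"

lemma finite_cube: "finite (cube k n)"
  unfolding cube_def E_def by (intro finite_PiE) auto

text \<open>Outside \<open>{1..n}\<close> both points are \<open>undefined\<close>, so those
  arguments compare as equal.\<close>

lemma cube_le_iff:
  assumes "x \<in> cube k n" and "y \<in> cube k n"
  shows "x \<le> y \<longleftrightarrow> (\<forall>i\<in>{1..n}. x i \<le> y i)"
  using assms unfolding cube_def le_fun_def
  by (metis PiE_arb order_refl)

lemma cube_bound: "x \<in> cube k n \<Longrightarrow> i \<in> {1..n} \<Longrightarrow> x i \<le> k - 1"
  by (force simp: cube_def E_def dest: PiE_mem)

lemma filter_factors_in_factors:
  assumes "a \<in> cube k n"
  shows "filter_factors k n a \<in> factors k n"
  unfolding factors_def filter_factors_def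
proof (rule restrict_PiE_iff[THEN iffD2], rule ballI)
  fix i assume i: "i \<in> {1..n}"
  have "a i < k" using assms i by (auto simp: cube_def E_def dest: PiE_mem)
  thus "{a i..k - 1} \<in> Pow (E k) - {{}}" by (auto simp: E_def)
qed

text \<open>The upper bounds \<open>k - 1\<close> hold throughout the cube, so only the lower bounds
  \<open>a i\<close> restrict \<open>x\<close>. This turns inclusions between filters into
  comparisons of their least points.\<close>

lemma PiE_filter_factors:
  assumes "a \<in> cube k n"
  shows "Pi\<^sub>E {1..n} (filter_factors k n a) = {x \<in> cube k n. a \<le> x}"
proof (intro set_eqI iffI)
  fix x assume x: "x \<in> Pi\<^sub>E {1..n} (filter_factors k n a)"
  have b: "a i \<le> x i \<and> x i \<le> k - 1 \<and> a i < k" if "i \<in> {1..n}" for i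
    using PiE_mem[OF x that] PiE_mem[OF assms[unfolded cube_def] that] that
    by (auto simp: filter_factors_def E_def)
  have "x \<in> cube k n"
    using x b unfolding cube_def E_def by (fastforce simp: PiE_iff)
  thus "x \<in> {x \<in> cube k n. a \<le> x}"
    using b cube_le_iff[OF assms] by blast
next
  fix x assume "x \<in> {x \<in> cube k n. a \<le> x}"
  thus "x \<in> Pi\<^sub>E {1..n} (filter_factors k n a)"
    using cube_bound[of x k n]
    by (auto simp: filter_factors_def cube_def PiE_iff le_fun_def)
qed

lemma factors_memD:
  assumes "M \<in> factors k n" and "i \<in> {1..n}"
  shows "M i \<subseteq> E k" and "finite (M i)" and "M i \<noteq> {}"
  using PiE_mem[OF assms[unfolded factors_def]] finite_subset[of "M i" "E k"]
  by (auto simp: E_def)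

lemma PiE_factors_subset_cube:
  assumes "M \<in> factors k n"
  shows "Pi\<^sub>E {1..n} M \<subseteq> cube k n"
  unfolding cube_def using factors_memD(1)[OF assms] by (intro PiE_mono) auto

lemma least_point_in_PiE:
  assumes "M \<in> factors k n"
  shows "least_point n M \<in> Pi\<^sub>E {1..n} M"
  unfolding least_point_def using factors_memD[OF assms] by auto

lemma least_point_in_cube: "M \<in> factors k n \<Longrightarrow> least_point n M \<in> cube k n"
  by (rule subsetD[OF PiE_factors_subset_cube least_point_in_PiE])

lemma least_point_le:
  assumes "M \<in> factors k n" and "x \<in> Pi\<^sub>E {1..n} M"
  shows "least_point n M \<le> x"
proof -
  have "x \<in> cube k n" "least_point n M \<in> cube k n"
    using subsetD[OF PiE_factors_subset_cube[OF assms(1)] assms(2)]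
      least_point_in_cube[OF assms(1)] by simp_all
  moreover have "least_point n M i \<le> x i" if "i \<in> {1..n}" for i
    using that factors_memD(2)[OF assms(1) that] PiE_mem[OF assms(2) that]
    by (simp add: least_point_def)
  ultimately show ?thesis by (simp add: cube_le_iff)
qed

lemma PiE_subset_filter:
  assumes "M \<in> factors k n"
  shows "Pi\<^sub>E {1..n} M \<subseteq> Pi\<^sub>E {1..n} (filter_factors k n (least_point n M))"
  unfolding PiE_filter_factors[OF least_point_in_cube[OF assms]]
  using least_point_le[OF assms] PiE_factors_subset_cube[OF assms] by blast

text \<open>A nonempty product determines its factors, and outside the index set both families are
  \<open>undefined\<close>. Equal sublattices therefore give equal expressions.\<close>

lemma factors_eqI:
  assumes "M \<in> factors k n" and "M' \<in> factors k n"
    and "Pi\<^sub>E {1..n} M = Pi\<^sub>E {1..n} M'"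
  shows "M = M'"
proof -
  have "\<forall>i\<in>{1..n}. M i = M' i"
    using PiE_eq_iff_not_empty[of "{1..n}" M M'] assms factors_memD(3) by blast
  thus ?thesis
    using assms(1,2) unfolding factors_def by (metis PiE_ext)
qed

section \<open>Values of d.n.f.s\<close>

lemma dnf_value_eq:
  assumes "is_dnf k n D" and "x \<in> cube k n" and "1 \<le> n" and "g \<noteq> 0"
    and "\<forall>A\<in>#D. ec_const A \<in> {0, g}"
  shows "dnf_value k n D x = (if \<exists>A\<in>#D. ec_const A = g \<and> x \<in> ec_set n A then g else 0)"
proof -
  have v: "ec_value k n A x = (if x \<in> ec_set n A then ec_const A else 0)" if "A \<in># D" for A
    using assms(1-3) that by (intro ec_value_eq) (auto simp: is_dnf_def is_ec_def)
  show ?thesis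
  proof (cases "\<exists>A\<in>#D. ec_const A = g \<and> x \<in> ec_set n A")
    case True
    then obtain A where "A \<in># D" "ec_value k n A x = g" using v by auto
    thus ?thesis using True assms(5) v unfolding dnf_value_def
      by (auto intro!: Max_eqI)
  next
    case False
    thus ?thesis using assms(5) v unfolding dnf_value_def
      by (auto intro!: Max_eqI)
  qed
qed

text \<open>This bound and the next lemma serve for an arbitrary d.n.f., whose constants need not
  all be 0 or a single \<open>g\<close>.\<close>

lemma ec_value_le_dnf_value: "A \<in># D \<Longrightarrow> ec_value k n A x \<le> dnf_value k n D x"
  unfolding dnf_value_def by (intro Max_ge) auto

lemma dnf_value_attained:
  assumes "dnf_value k n D x \<noteq> 0"
  obtains A where "A \<in># D" and "ec_value k n A x = dnf_value k n D x"
proof -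
  have "dnf_value k n D x \<in> insert 0 ((\<lambda>A. ec_value k n A x) ` set_mset D)"
    unfolding dnf_value_def by (intro Max_in) auto
  with assms show thesis by (auto intro: that)
qed

section \<open>Maximal sublattices of a monotone quasi-Boolean function\<close>

locale monotone_quasi_boolean =
  fixes k n \<gamma> :: nat and f :: "(nat \<Rightarrow> nat) \<Rightarrow> nat"
  assumes n_pos: "1 \<le> n"
    and gamma: "\<gamma> \<in> E k - {0}"
    and f_range: "f \<in> cube k n \<rightarrow> {0, \<gamma>}"
    and f_mono: "mono_on (cube k n) f"
begin

abbreviation N :: "(nat \<Rightarrow> nat) set" where
  "N \<equiv> value_set k n \<gamma> f"

definition minimal_points :: "(nat \<Rightarrow> nat) set" where
  "minimal_points = {m \<in> N. \<forall>y\<in>N. y \<le> m \<longrightarrow> y = m}"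

abbreviation filter_conj :: "(nat \<Rightarrow> nat) \<Rightarrow> elem_conj" where
  "filter_conj a \<equiv> EC (filter_factors k n a) \<gamma>"

lemma N_subset_cube: "N \<subseteq> cube k n"
  by (auto simp: value_set_def)

text \<open>Monotonicity gives \<open>f y\<close> \<ge> \<gamma> > 0, and the only nonzero value
  available is \<gamma>.\<close>

lemma N_upward_closed:
  assumes "x \<in> N" and "y \<in> cube k n" and "x \<le> y"
  shows "y \<in> N"
proof -
  have "\<gamma> \<le> f y" using assms mono_onD[OF f_mono, of x y] by (auto simp: value_set_def)
  thus ?thesis using gamma f_range assms(2) by (auto simp: value_set_def Pi_iff)
qed

lemma minimal_points_subset: "minimal_points \<subseteq> N"
  by (auto simp: minimal_points_def)

lemma finite_minimal_points: "finite minimal_points"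
  using minimal_points_subset N_subset_cube finite_cube by (metis finite_subset)

lemma minimal_point_below:
  assumes "x \<in> N"
  obtains m where "m \<in> minimal_points" and "m \<le> x"
proof -
  have "finite N" using N_subset_cube finite_cube by (metis finite_subset)
  from finite_has_minimal2[OF this assms] obtain m
    where "m \<in> N" "m \<le> x" "\<forall>b\<in>N. b \<le> m \<longrightarrow> m = b" by blast
  thus thesis by (intro that) (auto simp: minimal_points_def)
qed

lemma PiE_filter_factors_subset_N:
  assumes "a \<in> N"
  shows "Pi\<^sub>E {1..n} (filter_factors k n a) \<subseteq> N"
  using PiE_filter_factors[of a k n] assms N_subset_cube N_upward_closed[OF assms] by blast

lemma least_point_in_N:
  assumes "M \<in> factors k n" and "Pi\<^sub>E {1..n} M \<subseteq> N"
  shows "least_point n M \<in> N"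
  using least_point_in_PiE[OF assms(1)] assms(2) by blast

lemma maximal_sublattice_iff:
  assumes "M \<in> factors k n"
  shows "maximal_sublattice k n \<gamma> f (Pi\<^sub>E {1..n} M) \<longleftrightarrow>
    (\<exists>m\<in>minimal_points. M = filter_factors k n m)"
proof
  assume max: "maximal_sublattice k n \<gamma> f (Pi\<^sub>E {1..n} M)"
  define a where "a = least_point n M"
  have aN: "a \<in> N"
    using max least_point_in_N[OF assms] by (simp add: a_def maximal_sublattice_def)
  \<comment> \<open>Maximality is tested only against filters of points of \<open>N\<close>.\<close>
  have not_below: "\<not> Pi\<^sub>E {1..n} M \<subset> Pi\<^sub>E {1..n} (filter_factors k n b)" if "b \<in> N" for b
    using max filter_factors_in_factors[OF subsetD[OF N_subset_cube that]]
      PiE_filter_factors_subset_N[OF that]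
    unfolding maximal_sublattice_def sublattice_def by blast
  have sub: "Pi\<^sub>E {1..n} M \<subseteq> Pi\<^sub>E {1..n} (filter_factors k n a)"
    unfolding a_def by (rule PiE_subset_filter[OF assms])
  have "M = filter_factors k n a"
    using factors_eqI[OF assms filter_factors_in_factors] not_below[OF aN] sub aN N_subset_cube
    by blast
  \<comment> \<open>The filter of a smaller point of \<open>N\<close> contains that of
    \<open>a\<close>, so maximality makes the two equal. Since \<open>y\<close> lies in its own
    filter, \<open>a\<close> \<le> \<open>y\<close> follows.\<close>
  moreover have "y = a" if y: "y \<in> N" "y \<le> a" for y
  proof -
    have eq: "Pi\<^sub>E {1..n} (filter_factors k n z) = {x \<in> cube k n. z \<le> x}" if "z \<in> N" for z
      using that N_subset_cube by (intro PiE_filter_factors) auto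
    have "Pi\<^sub>E {1..n} M \<subseteq> Pi\<^sub>E {1..n} (filter_factors k n y)"
      using sub eq[OF aN] eq[OF y(1)] y(2) by (auto intro: order_trans)
    hence "Pi\<^sub>E {1..n} M = Pi\<^sub>E {1..n} (filter_factors k n y)"
      using not_below[OF y(1)] by blast
    hence "{x \<in> cube k n. y \<le> x} \<subseteq> {x \<in> cube k n. a \<le> x}"
      using sub eq[OF aN] eq[OF y(1)] by simp
    hence "a \<le> y" using subsetD[OF N_subset_cube y(1)] by auto
    with y(2) show ?thesis by (rule antisym)
  qed
  ultimately show "\<exists>m\<in>minimal_points. M = filter_factors k n m"
    using aN by (auto simp: minimal_points_def)
next
  assume "\<exists>m\<in>minimal_points. M = filter_factors k n m"
  then obtain m where m: "m \<in> minimal_points" and M: "M = filter_factors k n m" by blast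
  have mN: "m \<in> N" and mc: "m \<in> cube k n"
    using m minimal_points_subset N_subset_cube by auto
  \<comment> \<open>A larger sublattice inside \<open>N\<close> contains \<open>m\<close>, so its
    least point is below \<open>m\<close> and equals \<open>m\<close> by minimality. It then lies
    inside the filter of \<open>m\<close> and cannot be strictly larger.\<close>
  have "\<not> Pi\<^sub>E {1..n} M \<subset> Pi\<^sub>E {1..n} M'"
    if M': "M' \<in> factors k n" "Pi\<^sub>E {1..n} M' \<subseteq> N" for M'
  proof
    assume less: "Pi\<^sub>E {1..n} M \<subset> Pi\<^sub>E {1..n} M'"
    have "m \<in> Pi\<^sub>E {1..n} M" unfolding M PiE_filter_factors[OF mc] using mc by simp
    hence "least_point n M' \<le> m" using less least_point_le[OF M'(1)] by blast
    hence "least_point n M' = m"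
      using m least_point_in_N[OF M'] by (simp add: minimal_points_def)
    thus False using less PiE_subset_filter[OF M'(1)] by (simp add: M)
  qed
  thus "maximal_sublattice k n \<gamma> f (Pi\<^sub>E {1..n} M)"
    unfolding maximal_sublattice_def sublattice_def
    using assms PiE_filter_factors_subset_N[OF mN] M by blast
qed

section \<open>The abbreviated d.n.f. as a family indexed by minimal points\<close>

lemma inj_on_filter_conj: "inj_on filter_conj minimal_points"
proof (rule inj_onI)
  fix a b assume ab: "a \<in> minimal_points" "b \<in> minimal_points" "filter_conj a = filter_conj b"
  have c: "a \<in> cube k n" "b \<in> cube k n"
    using ab minimal_points_subset N_subset_cube by auto
  have "{x \<in> cube k n. a \<le> x} = {x \<in> cube k n. b \<le> x}"
    using ab(3) PiE_filter_factors[OF c(1)] PiE_filter_factors[OF c(2)] by simp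
  thus "a = b" using c by (blast intro: antisym)
qed

text \<open>Distinct minimal points have distinct filters, so each contributes exactly one disjunct.
  The index multiset is kept visible in order to count disjuncts and to pair them with those of
  another d.n.f.\<close>

lemma abbreviated_dnf_eq:
  "abbreviated_dnf k n \<gamma> f = image_mset filter_conj (mset_set minimal_points)"
proof -
  have "{EC M \<gamma> | M. M \<in> factors k n \<and> maximal_sublattice k n \<gamma> f (Pi\<^sub>E {1..n} M)}
    = filter_conj ` minimal_points"
    using maximal_sublattice_iff filter_factors_in_factors minimal_points_subset N_subset_cube
    by blast
  thus ?thesis
    by (simp add: abbreviated_dnf_def image_mset_mset_set[OF inj_on_filter_conj])
qed

text \<open>A point is covered iff some minimal point lies below it. By finiteness and upward
  closure of \<open>N\<close> this means that the point is in \<open>N\<close>.\<close>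

lemma realizes_abbreviated_dnf: "realizes k n (abbreviated_dnf k n \<gamma> f) f"
  unfolding realizes_def
proof (intro conjI ballI)
  let ?D = "abbreviated_dnf k n \<gamma> f"
  have set: "set_mset ?D = filter_conj ` minimal_points"
    by (simp add: abbreviated_dnf_eq finite_minimal_points)
  show dnf: "is_dnf k n ?D"
    using filter_factors_in_factors minimal_points_subset N_subset_cube gamma
    by (auto simp: is_dnf_def is_ec_def set)
  fix x assume x: "x \<in> cube k n"
  have "dnf_value k n ?D x = (if \<exists>A\<in>#?D. ec_const A = \<gamma> \<and> x \<in> ec_set n A then \<gamma> else 0)"
    using dnf x n_pos gamma by (intro dnf_value_eq) (auto simp: set)
  moreover have "(\<exists>A\<in>#?D. ec_const A = \<gamma> \<and> x \<in> ec_set n A) \<longleftrightarrow> (\<exists>m\<in>minimal_points. m \<le> x)"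
  proof -
    have "x \<in> ec_set n (filter_conj m) \<longleftrightarrow> m \<le> x" if "m \<in> minimal_points" for m
      using x PiE_filter_factors[of m k n] that minimal_points_subset N_subset_cube
      by (auto simp: ec_set_def)
    thus ?thesis unfolding set by auto
  qed
  moreover have "(\<exists>m\<in>minimal_points. m \<le> x) \<longleftrightarrow> x \<in> N"
    using minimal_point_below N_upward_closed[OF _ x] minimal_points_subset by blast
  ultimately show "dnf_value k n ?D x = f x"
    using x f_range by (auto simp: value_set_def Pi_iff)
qed

section \<open>Minimal points in an arbitrary d.n.f\<close>

lemma conj_covering_minimal_point:
  assumes D: "realizes k n D f" and m: "m \<in> minimal_points"
  obtains A where "A \<in># D" and "m = least_point n (ec_factors A)"
    and "absorbed n A (filter_conj m)" and "m \<in> ec_set n A"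
proof -
  have mN: "m \<in> N" and mc: "m \<in> cube k n"
    using m minimal_points_subset N_subset_cube by auto
  have fm: "dnf_value k n D m = \<gamma>" using D mc mN by (simp add: realizes_def value_set_def)
  obtain A where A: "A \<in># D" and Am: "ec_value k n A m = \<gamma>"
    using dnf_value_attained[of k n D m] fm gamma by auto
  have ec: "ec_factors A \<in> factors k n" "ec_const A \<in> E k"
    using D A by (auto simp: realizes_def is_dnf_def is_ec_def)
  have mA: "m \<in> ec_set n A" and cA: "ec_const A = \<gamma>"
    using Am ec_value_eq[OF ec(2) mc n_pos] gamma by (auto split: if_splits)
  \<comment> \<open>On its whole sublattice \<open>A\<close> contributes \<gamma> to the maximum,
    which forces \<open>f\<close> up to \<gamma> there.\<close>
  have sub: "ec_set n A \<subseteq> N"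
  proof
    fix x assume x: "x \<in> ec_set n A"
    have xc: "x \<in> cube k n" using x PiE_factors_subset_cube[OF ec(1)] by (auto simp: ec_set_def)
    have "\<gamma> \<le> f x"
      using ec_value_le_dnf_value[OF A, of k n x] ec_value_eq[OF ec(2) xc n_pos] x xc cA D
      by (simp add: realizes_def)
    thus "x \<in> N" using xc f_range gamma by (auto simp: value_set_def Pi_iff)
  qed
  have "least_point n (ec_factors A) \<le> m" "least_point n (ec_factors A) \<in> N"
    using least_point_le[OF ec(1)] least_point_in_N[OF ec(1)] mA sub by (auto simp: ec_set_def)
  \<comment> \<open>The least point of \<open>A\<close> is a point of \<open>N\<close> below the
    minimal point \<open>m\<close>.\<close>
  hence eq: "m = least_point n (ec_factors A)" using m by (auto simp: minimal_points_def)
  have "absorbed n A (filter_conj m)"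
    using PiE_subset_filter[OF ec(1)] cA by (simp add: absorbed_def ec_set_def eq)
  with A eq mA show thesis by (intro that)
qed

text \<open>Inclusion of multisets gives the lower bound on the length of \<open>D\<close>, and also
  equality with \<open>D\<close> when the lengths agree.\<close>

lemma covering_choice:
  assumes "realizes k n D f"
  obtains \<phi> where "image_mset \<phi> (mset_set minimal_points) \<subseteq># D"
    and "\<forall>m\<in>minimal_points. absorbed n (\<phi> m) (filter_conj m) \<and> m \<in> ec_set n (\<phi> m)"
proof -
  have "\<forall>m\<in>minimal_points. \<exists>A. A \<in># D \<and> m = least_point n (ec_factors A) \<and>
      absorbed n A (filter_conj m) \<and> m \<in> ec_set n A"
    using conj_covering_minimal_point[OF assms] by metis
  then obtain \<phi> where \<phi>: "\<forall>m\<in>minimal_points. \<phi> m \<in># D \<and> m = least_point n (ec_factors (\<phi> m)) \<and>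
      absorbed n (\<phi> m) (filter_conj m) \<and> m \<in> ec_set n (\<phi> m)"
    by metis
  \<comment> \<open>Each \<open>m\<close> is recovered from \<open>\<phi> m\<close> as the least
    point of its factors.\<close>
  have "inj_on \<phi> minimal_points" using \<phi> by (metis inj_onI)
  hence "image_mset \<phi> (mset_set minimal_points) = mset_set (\<phi> ` minimal_points)"
    by (rule image_mset_mset_set)
  also have "\<dots> \<subseteq># mset_set (set_mset D)"
    using \<phi> by (intro subset_imp_msubset_mset_set) auto
  also have "\<dots> \<subseteq># D" by (rule mset_set_set_mset_msubset)
  finally show thesis using \<phi> by (intro that) auto
qed

section \<open>Shortest d.n.f.s and uniqueness\<close>

lemma minimal_dnf_abbreviated: "minimal_dnf k n f (abbreviated_dnf k n \<gamma> f)"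
proof -
  have "size (abbreviated_dnf k n \<gamma> f) \<le> size D" if "realizes k n D f" for D
    using covering_choice[OF that] size_mset_mono by (metis abbreviated_dnf_eq size_image_mset)
  thus ?thesis using realizes_abbreviated_dnf by (simp add: minimal_dnf_def)
qed

text \<open>A shortest d.n.f. has no room beyond one conjunction per minimal point, since the
  abbreviated one already attains that length.\<close>

lemma minimal_dnf_choice:
  assumes "minimal_dnf k n f D"
  obtains \<phi> where "D = image_mset \<phi> (mset_set minimal_points)"
    and "\<forall>m\<in>minimal_points. absorbed n (\<phi> m) (filter_conj m) \<and> m \<in> ec_set n (\<phi> m)"
proof -
  have D: "realizes k n D f" using assms by (simp add: minimal_dnf_def)
  have "size D \<le> size (mset_set minimal_points)"
    using assms realizes_abbreviated_dnf by (auto simp: minimal_dnf_def abbreviated_dnf_eq)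
  with covering_choice[OF D] show thesis
    by (metis that mset_subset_size size_image_mset subset_mset.le_neq_trans not_le)
qed

lemma minimal_dnf_absorbed:
  assumes "minimal_dnf k n f D"
  shows "rel_mset (absorbed n) D (abbreviated_dnf k n \<gamma> f)"
proof -
  obtain \<phi> where D: "D = image_mset \<phi> (mset_set minimal_points)"
    and \<phi>: "\<forall>m\<in>minimal_points. absorbed n (\<phi> m) (filter_conj m) \<and> m \<in> ec_set n (\<phi> m)"
    using minimal_dnf_choice[OF assms] .
  \<comment> \<open>Both d.n.f.s are images of the same index multiset, so matching each
    \<open>m\<close> with itself suffices.\<close>
  have "rel_mset (\<lambda>m m'. absorbed n (\<phi> m) (filter_conj m'))
      (mset_set minimal_points) (mset_set minimal_points)"
    using \<phi> finite_minimal_points by (intro multiset.rel_refl_strong) auto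
  thus ?thesis by (simp add: D abbreviated_dnf_eq multiset.rel_map)
qed

text \<open>The maximal sublattice of \<open>\<phi> m\<close> is the filter of some minimal point
  \<open>a\<close>. It contains \<open>m\<close>, so \<open>a\<close> \<le> \<open>m\<close>, and
  minimality of \<open>m\<close> gives \<open>a\<close> = \<open>m\<close>.\<close>

lemma minimal_dnf_unique:
  assumes "minimal_dnf k n f D"
    and max: "\<forall>A\<in>#D. maximal_sublattice k n \<gamma> f (ec_set n A)"
  shows "D = abbreviated_dnf k n \<gamma> f"
proof -
  obtain \<phi> where D: "D = image_mset \<phi> (mset_set minimal_points)"
    and \<phi>: "\<forall>m\<in>minimal_points. absorbed n (\<phi> m) (filter_conj m) \<and> m \<in> ec_set n (\<phi> m)"
    using minimal_dnf_choice[OF assms(1)] .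
  have "\<phi> m = filter_conj m" if m: "m \<in> minimal_points" for m
  proof -
    have A: "\<phi> m \<in># D" using m by (simp add: D finite_minimal_points)
    hence "ec_factors (\<phi> m) \<in> factors k n"
      using assms(1) by (auto simp: minimal_dnf_def realizes_def is_dnf_def is_ec_def)
    then obtain a where a: "a \<in> minimal_points" "ec_factors (\<phi> m) = filter_factors k n a"
      using maximal_sublattice_iff max A by (auto simp: ec_set_def)
    have "a \<in> cube k n" using a minimal_points_subset N_subset_cube by auto
    moreover have "m \<in> Pi\<^sub>E {1..n} (filter_factors k n a)"
      using \<phi> m by (simp add: ec_set_def flip: a(2))
    ultimately have "a \<le> m" using PiE_filter_factors by blast
    hence "a = m" using a(1) m by (simp add: minimal_points_def)
    \<comment> \<open>Maximality concerns only the sublattice; the constant is obtained from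
      absorption.\<close>
    moreover have "ec_const (\<phi> m) = \<gamma>" using \<phi> m by (simp add: absorbed_def)
    ultimately show ?thesis using a(2) by (cases "\<phi> m") simp
  qed
  thus ?thesis
    unfolding D abbreviated_dnf_eq using finite_minimal_points by (intro image_mset_cong) auto
qed

lemma abbreviated_dnf_shape:
  assumes "A \<in># abbreviated_dnf k n \<gamma> f"
  shows "\<exists>a. (\<forall>i\<in>{1..n}. a i \<le> k - 1) \<and> A = EC (\<lambda>i\<in>{1..n}. {a i..k - 1}) \<gamma>"
proof -
  obtain a where a: "a \<in> minimal_points" "A = filter_conj a"
    using assms by (auto simp: abbreviated_dnf_eq finite_minimal_points)
  have "a \<in> cube k n" using a(1) minimal_points_subset N_subset_cube by auto
  hence "\<forall>i\<in>{1..n}. a i \<le> k - 1" using cube_bound by blast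
  thus ?thesis using a(2) unfolding filter_factors_def by blast
qed

end

theorem theorem1:
  fixes k n \<gamma> :: nat and f :: "(nat \<Rightarrow> nat) \<Rightarrow> nat"
  assumes "k \<ge> 2" and "n \<ge> 1"
    and "\<gamma> \<in> E k - {0}"
    and "f \<in> cube k n \<rightarrow> {0, \<gamma>}"
    and "mono_on (cube k n) f"
  shows "(\<forall>A\<in>#abbreviated_dnf k n \<gamma> f.
            \<exists>a. (\<forall>i\<in>{1..n}. a i \<le> k - 1) \<and> A = EC (\<lambda>i\<in>{1..n}. {a i..k - 1}) \<gamma>)
       \<and> minimal_dnf k n f (abbreviated_dnf k n \<gamma> f)
       \<and> (\<forall>D. minimal_dnf k n f D \<and> (\<forall>A\<in>#D. maximal_sublattice k n \<gamma> f (ec_set n A))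
            \<longrightarrow> D = abbreviated_dnf k n \<gamma> f)
       \<and> (\<forall>D. minimal_dnf k n f D \<longrightarrow> rel_mset (absorbed n) D (abbreviated_dnf k n \<gamma> f))"
proof -
  interpret monotone_quasi_boolean k n \<gamma> f
    using assms(2-5) by unfold_locales
  show ?thesis
    using abbreviated_dnf_shape minimal_dnf_abbreviated minimal_dnf_unique minimal_dnf_absorbed
    by blast
qed

end
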